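(* Let $M\ge 2$ be an integer, let $\mathcal{D}_N(M)$ be the set of the partitions of $N$ in which each part is repeated strictly less than $M$ times, and let $\mathcal{C}_N(M)$ be the set of the partitions of $N$ with parts not congruent to $0$ modulo $M$. (1) Let $b_M\colon \mathcal{D}_N(M)\to \mathcal{C}_N(M)$ be defined as follows: for every $\lambda\in \mathcal{D}_N(M)$, divide by $M$ each part of $\lambda$ divisible by $M$ (that is, replace each such part $a$ by $M$ parts equal to $a/M$), and iterate this step until all the resulting parts are not divisible by $M$ anymore. Then $b_M$ is a bijection, and its inverse $b_M^{-1}$ is given, for $\mu\in \mathcal{C}_N(M)$, by summing up all the $M$-tuples of equal parts of $\mu$ (each such $M$-tuple being replaced by its sum) and iterating this process until there are no more $M$ equal parts. (2) The following identity holds: $$\prod_{k\not\equiv 0 \bmod M}\frac{1}{1-q^k}= 1+ \sum_{n=1}^{\infty}\frac{(q^{n}-q^{nM})\,(q^M)_{n-1}}{(q)_n}.$$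
   Context: $N$ is a positive integer. In the product, $k$ ranges over the positive integers not divisible by $M$. For $n\in\mathbb{Z}$, $(q)_n:=\prod_{s=1}^n(1-q^s)$ if $n>0$ and $(q)_n:=1$ if $n\le 0$. The symbol $(q^M)_{n-1}$ denotes $(q)_{n-1}$ with $q$ replaced by $q^M$, i.e. $(q^M)_{n-1}=\prod_{j=1}^{n-1}(1-q^{jM})$, equal to $1$ for $n=1$. *)

theory Defs
  imports "HOL-Analysis.Analysis" "HOL-Library.Multiset" "HOL-Library.While_Combinator"
    "HOL-Number_Theory.Cong"
begin

definition partitions :: "nat \<Rightarrow> nat multiset set" where
  "partitions N = {p. 0 \<notin># p \<and> sum_mset p = N}"

definition D_partitions :: "nat \<Rightarrow> nat \<Rightarrow> nat multiset set" where
  "D_partitions M N = {p \<in> partitions N. \<forall>a\<in>#p. count p a < M}"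

definition C_partitions :: "nat \<Rightarrow> nat \<Rightarrow> nat multiset set" where
  "C_partitions M N = {p \<in> partitions N. \<forall>a\<in>#p. \<not> [a = 0] (mod M)}"

text \<open>One step of either procedure acts simultaneously on the whole multiset: every part
  divisible by \<open>M\<close> is split, respectively as many disjoint \<open>M\<close>-tuples of equal parts as possible
  are replaced by their sums.  The value of
  \<^const>\<open>while_option\<close> is \<^const>\<open>None\<close> exactly if the iteration never stops.\<close>

definition split_step :: "nat \<Rightarrow> nat multiset \<Rightarrow> nat multiset" where
  "split_step M p = (\<Sum>a\<in>#p. if M dvd a then replicate_mset M (a div M) else {#a#})"

definition split_iter :: "nat \<Rightarrow> nat multiset \<Rightarrow> nat multiset option" where
  "split_iter M = while_option (\<lambda>p. \<exists>a\<in>#p. M dvd a) (split_step M)"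

definition b_map :: "nat \<Rightarrow> nat multiset \<Rightarrow> nat multiset" where
  "b_map M p = the (split_iter M p)"

definition merge_step :: "nat \<Rightarrow> nat multiset \<Rightarrow> nat multiset" where
  "merge_step M p = (\<Sum>a\<in>set_mset p.
     replicate_mset (count p a mod M) a + replicate_mset (count p a div M) (M * a))"

definition merge_iter :: "nat \<Rightarrow> nat multiset \<Rightarrow> nat multiset option" where
  "merge_iter M = while_option (\<lambda>p. \<exists>a\<in>#p. M \<le> count p a) (merge_step M)"

text \<open>For \<open>n \<le> 0\<close> the product is empty, since then \<open>nat n = 0\<close>.\<close>

definition q_factorial :: "'a::comm_ring_1 \<Rightarrow> int \<Rightarrow> 'a" where
  "q_factorial q n = (\<Prod>s = 1..nat n. 1 - q ^ s)"

end

theory Submission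
  imports Defs
begin

text \<open>
  Let \<open>full_split M p\<close> replace each part \<open>a = M ^ v * c\<close> of \<open>p\<close>, where \<open>M\<close> does not divide \<open>c\<close>, by
  \<open>M ^ v\<close> copies of \<open>c\<close>.  Splitting and merging steps leave \<open>full_split M p\<close> unchanged.  The
  splitting procedure therefore ends in \<open>full_split M p\<close> itself.  In the other direction, a
  multiset whose multiplicities are all less than \<open>M\<close> is determined by its full splitting, because
  the multiplicities of the parts \<open>M ^ v * c\<close> are the base \<open>M\<close> digits of the multiplicity of \<open>c\<close>
  in it; so merging inverts splitting.

  For the identity, \<open>(q\<^sup>M)\<^sub>n / (q)\<^sub>n - (q\<^sup>M)\<^sub>n\<^sub>-\<^sub>1 / (q)\<^sub>n\<^sub>-\<^sub>1\<close> is the \<open>n\<close>-th term of the series.  The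
  sum telescopes, and its partial sums agree with those of the product up to order \<open>n\<close>.
\<close>

subsection \<open>Full splitting\<close>

definition full_split :: "nat \<Rightarrow> nat multiset \<Rightarrow> nat multiset" where
  "full_split M p =
    (\<Sum>a\<in>#p. replicate_mset (M ^ multiplicity M a) (a div M ^ multiplicity M a))"

lemma full_split_empty [simp]: "full_split M {#} = {#}"
  by (simp add: full_split_def)

lemma full_split_add_mset [simp]:
  "full_split M (add_mset a p) =
    replicate_mset (M ^ multiplicity M a) (a div M ^ multiplicity M a) + full_split M p"
  by (simp add: full_split_def)

lemma full_split_union [simp]: "full_split M (p + q) = full_split M p + full_split M q"
  by (simp add: full_split_def)

lemma full_split_sum: "full_split M (\<Sum>a\<in>A. f a) = (\<Sum>a\<in>A. full_split M (f a))"
  by (induction A rule: infinite_finite_induct) auto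

lemma full_split_replicate [simp]:
  "full_split M (replicate_mset k a) =
    replicate_mset (k * M ^ multiplicity M a) (a div M ^ multiplicity M a)"
  by (induction k) (auto simp: multiset_eq_iff)

lemma sum_mset_full_split [simp]: "\<Sum>\<^sub># (full_split M p) = \<Sum>\<^sub># p"
  by (induction p) (simp_all add: multiplicity_dvd)

lemma zero_notin_full_split:
  assumes "0 \<notin># p"
  shows "0 \<notin># full_split M p"
  using assms
  by (induction p) (auto simp: dvd_div_eq_0_iff multiplicity_dvd split: if_splits)

lemma full_split_not_dvd:
  assumes "M \<ge> 2" "0 \<notin># p" "a \<in># full_split M p"
  shows "\<not> M dvd a"
  using assms(2,3)
proof (induction p)
  case (add b p)
  then show ?case
    using multiplicity_decompose[of b M] assms(1) by (auto split: if_splits)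
qed auto

lemma full_split_id:
  assumes "\<forall>a\<in>#p. \<not> M dvd a"
  shows "full_split M p = p"
  using assms by (induction p) (auto simp: not_dvd_imp_multiplicity_0)

text \<open>\<open>M\<close> may be composite, so multiplicities need not add up over products;
  multiplying by \<open>M\<close> itself still raises them by exactly one.\<close>

lemma multiplicity_mult_base:
  fixes M a :: nat
  assumes "M \<ge> 2" "a > 0"
  shows "multiplicity M (M * a) = Suc (multiplicity M a)"
  using assms by (intro multiplicity_times_same) auto

text \<open>Write \<open>a = M ^ v * c\<close>. A part \<open>b > a\<close> contributes copies of
  \<open>c\<close> only if \<open>b = M ^ w * c\<close>, and then \<open>w > v\<close>. So larger
  parts do not affect the base \<open>M\<close> digit at position \<open>v\<close>.\<close>

lemma power_dvd_count_full_split: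
  assumes "M \<ge> 2" "\<forall>b\<in>#p. a < b"
  shows "M ^ Suc (multiplicity M a) dvd
    count (full_split M p) (a div M ^ multiplicity M a)"
  using assms(2)
proof (induction p)
  case (add b p)
  have "M ^ Suc (multiplicity M a) dvd M ^ multiplicity M b"
    if eq: "b div M ^ multiplicity M b = a div M ^ multiplicity M a"
  proof -
    define c where "c = a div M ^ multiplicity M a"
    have "a = c * M ^ multiplicity M a" "b = c * M ^ multiplicity M b"
      using eq by (metis c_def dvd_div_mult_self multiplicity_dvd)+
    moreover have "a < b" using add.prems by simp
    ultimately have "M ^ multiplicity M a < M ^ multiplicity M b"
      by (metis mult_less_cancel1)
    then have "multiplicity M a < multiplicity M b"
      using assms(1) by simp
    then show ?thesis
      by (intro le_imp_power_dvd) simp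
  qed
  with add show ?case by (auto intro!: dvd_add)
qed auto

lemma full_split_inject:
  assumes "M \<ge> 2" "\<forall>a. count p a < M" "\<forall>a. count q a < M"
    and eq: "full_split M p = full_split M q"
  shows "p = q"
proof (rule multiset_eqI)
  fix a
  show "count p a = count q a"
  proof (induction a rule: less_induct)
    case (less a)
    define v where "v = multiplicity M a"
    define c where "c = a div M ^ v"
    \<comment> \<open>The copies of \<open>c\<close> are counted separately for the parts below,
      equal to and above \<open>a\<close>. Those from below agree for \<open>p\<close> and
      \<open>q\<close> by induction, and those from above disappear modulo
      \<open>M ^ Suc v\<close>.\<close>
    have decomp: "\<exists>u. count (full_split M r) c =
        count (full_split M (filter_mset (\<lambda>b. b < a) r)) c + count r a * M ^ v + u * M ^ Suc v" for r
    proof -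
      have "r = filter_mset (\<lambda>b. b < a) r + replicate_mset (count r a) a
          + filter_mset (\<lambda>b. a < b) r"
        by (rule multiset_eqI) auto
      then have "full_split M r = full_split M (filter_mset (\<lambda>b. b < a) r)
          + replicate_mset (count r a * M ^ v) c + full_split M (filter_mset (\<lambda>b. a < b) r)"
        by (metis full_split_union full_split_replicate v_def c_def)
      moreover have "M ^ Suc v dvd count (full_split M (filter_mset (\<lambda>b. a < b) r)) c"
        unfolding v_def c_def by (rule power_dvd_count_full_split[OF assms(1)]) auto
      ultimately show ?thesis
        by (auto elim!: dvdE simp: mult.commute)
    qed
    obtain u w where
      "count (full_split M p) c =
        count (full_split M (filter_mset (\<lambda>b. b < a) p)) c + count p a * M ^ v + u * M ^ Suc v"
      "count (full_split M q) c =
        count (full_split M (filter_mset (\<lambda>b. b < a) q)) c + count q a * M ^ v + w * M ^ Suc v"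
      using decomp by metis
    moreover have "filter_mset (\<lambda>b. b < a) p = filter_mset (\<lambda>b. b < a) q"
      using less by (intro multiset_eqI) auto
    ultimately have "(count p a + u * M) * M ^ v = (count q a + w * M) * M ^ v"
      using eq by (simp add: algebra_simps)
    then have "count p a + u * M = count q a + w * M"
      using assms(1) by simp
    then have "(count p a + u * M) mod M = (count q a + w * M) mod M"
      by simp
    then show ?case
      using assms by simp
  qed
qed

subsection \<open>The two procedures\<close>

lemma split_step_add_mset:
  "split_step M (add_mset a p) =
    (if M dvd a then replicate_mset M (a div M) else {#a#}) + split_step M p"
  by (simp add: split_step_def)

lemma zero_notin_split_step:
  assumes "0 \<notin># p"
  shows "0 \<notin># split_step M p"
  using assms
  by (induction p) (auto simp: split_step_add_mset split_step_def dvd_div_eq_0_iff split: if_splits)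

text \<open>With \<open>v\<close> the multiplicity of \<open>M\<close> in \<open>b\<close>, the part
  \<open>M * b\<close> and \<open>M\<close> copies of \<open>b\<close> both yield
  \<open>M ^ Suc v\<close> copies of the same number. The part 0 is excluded, since a step would
  replace it by \<open>M\<close> zeros.\<close>

lemma full_split_split_step:
  assumes "M \<ge> 2" "0 \<notin># p"
  shows "full_split M (split_step M p) = full_split M p"
  using assms(2)
proof (induction p)
  case empty
  show ?case by (simp add: split_step_def)
next
  case (add a p)
  show ?case
  proof (cases "M dvd a")
    case True
    then obtain b where "a = M * b" by auto
    then show ?thesis
      using add assms(1) by (simp add: split_step_add_mset multiplicity_mult_base)
  qed (use add in \<open>simp add: split_step_add_mset\<close>)
qed

lemma sum_squares_split_step_le: "(\<Sum>a\<in>#split_step M p. a * a) \<le> (\<Sum>a\<in>#p. a * a)"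
proof (induction p)
  case empty
  show ?case by (simp add: split_step_def)
next
  case (add a p)
  have "M * ((a div M) * (a div M)) \<le> a * a" if "M dvd a"
    using that by (cases "M = 0") (auto elim!: dvdE)
  then show ?case
    using add by (auto simp: split_step_add_mset intro!: add_mono)
qed

text \<open>Termination measure for splitting: \<open>a = M * b\<close> contributes
  \<open>M * M * b * b\<close> before the step and only \<open>M * b * b\<close> after it, while the
  other parts contribute no more than before.\<close>

lemma sum_squares_split_step_less:
  assumes "M \<ge> 2" "0 \<notin># p" "\<exists>a\<in>#p. M dvd a"
  shows "(\<Sum>a\<in>#split_step M p. a * a) < (\<Sum>a\<in>#p. a * a)"
proof -
  obtain a r where p: "p = add_mset a r" and "M dvd a"
    using assms(3) by (metis multi_member_split)
  then obtain b where a: "a = M * b" by auto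
  then have "b > 0" using assms(2) p by (cases b) auto
  then have "M * (b * b) < a * a"
    using a assms(1) by simp
  then show ?thesis
    using add_less_le_mono[OF _ sum_squares_split_step_le[of M r]] p a assms(1)
    by (simp add: split_step_add_mset)
qed

lemma split_iter_eq_full_split:
  assumes "M \<ge> 2" "0 \<notin># p"
  shows "split_iter M p = Some (full_split M p)"
proof -
  \<comment> \<open>\<open>P\<close> is the loop invariant. On exit no part is divisible by
    \<open>M\<close>, so \<open>full_split\<close> fixes the result, which therefore equals
    \<open>full_split M p\<close>.\<close>
  define P where "P r \<longleftrightarrow> 0 \<notin># r \<and> full_split M r = full_split M p" for r
  have step: "P (split_step M r)" if "P r" for r
    using that assms(1) by (simp add: P_def zero_notin_split_step full_split_split_step)
  have init: "P p" using assms by (simp add: P_def)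
  obtain t where t: "split_iter M p = Some t"
    unfolding split_iter_def
    using measure_while_option_Some[of P "\<lambda>p. \<exists>a\<in>#p. M dvd a" "split_step M"
        "\<lambda>p. \<Sum>a\<in>#p. a * a" p] step init sum_squares_split_step_less[OF assms(1)]
    by (auto simp: P_def)
  have "P t"
    using while_option_rule[of P, OF _ t[unfolded split_iter_def] init] step by blast
  moreover have "\<forall>a\<in>#t. \<not> M dvd a"
    using while_option_stop[OF t[unfolded split_iter_def]] by blast
  ultimately show ?thesis
    using t full_split_id by (simp add: P_def)
qed

section \<open>Merging: invariant and termination\<close>

lemma zero_notin_merge_step:
  assumes "M \<ge> 2" "0 \<notin># p"
  shows "0 \<notin># merge_step M p"
  using assms
  by (auto simp: merge_step_def set_mset_sum split: if_splits) (metis gr0I)+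

text \<open>Brings \<open>p\<close> into the shape of \<open>merge_step\<close>, a sum over distinct
  parts, so that the two can be compared term by term.\<close>

lemma multiset_eq_sum_replicate: "p = (\<Sum>a\<in>set_mset p. replicate_mset (count p a) a)"
  by (rule multiset_eqI) (auto simp: count_sum if_distrib sum.delta' not_in_iff cong: if_cong)

lemma full_split_merge_step:
  assumes "M \<ge> 2" "0 \<notin># p"
  shows "full_split M (merge_step M p) = full_split M p"
proof -
  have "full_split M (replicate_mset (count p a mod M) a
        + replicate_mset (count p a div M) (M * a))
      = full_split M (replicate_mset (count p a) a)" if "a \<in># p" for a
  proof -
    have "a > 0" using that assms(2) by (cases a) auto
    have "replicate_mset (k mod M * m) c + replicate_mset (k div M * (M * m)) c
        = replicate_mset (k * m) c" for k m c :: nat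
    proof -
      have "k mod M * m + k div M * (M * m) = (k mod M + k div M * M) * m"
        by (simp only: algebra_simps)
      also have "\<dots> = k * m" by simp
      finally show ?thesis by (auto simp: multiset_eq_iff)
    qed
    then show ?thesis
      using assms(1) \<open>a > 0\<close> by (simp add: multiplicity_mult_base)
  qed
  then have "full_split M (merge_step M p)
      = full_split M (\<Sum>a\<in>set_mset p. replicate_mset (count p a) a)"
    unfolding merge_step_def full_split_sum by (intro sum.cong) auto
  then show ?thesis
    by (simp flip: multiset_eq_sum_replicate)
qed

text \<open>Each merged \<open>M\<close>-tuple becomes a single part, a loss of \<open>M - 1\<close>
  parts; the number of parts is thus a termination measure.\<close>

lemma size_merge_step_less:
  assumes "M \<ge> 2" "\<exists>a\<in>#p. M \<le> count p a"
  shows "size (merge_step M p) < size p"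
proof -
  have div_mod: "k mod M + k div M + k div M * (M - 1) = k" for k
  proof -
    have "k div M + k div M * (M - 1) = k div M * M"
      using assms(1) by (cases M) auto
    then show ?thesis by (simp add: add.assoc)
  qed
  have "size (merge_step M p) = (\<Sum>a\<in>set_mset p. count p a mod M + count p a div M)"
    unfolding merge_step_def by (induction rule: finite_induct[OF finite_set_mset]) auto
  also have "\<dots> < (\<Sum>a\<in>set_mset p. count p a)"
  proof (rule sum_strict_mono_ex1)
    show "\<forall>a\<in>set_mset p. count p a mod M + count p a div M \<le> count p a"
      by (metis div_mod le_add1)
    obtain a where a: "a \<in># p" "M \<le> count p a" using assms(2) by blast
    then have "count p a div M * (M - 1) > 0"
      using assms(1) by (simp add: div_greater_zero_iff)
    then have "count p a mod M + count p a div M < count p a"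
      using div_mod[of "count p a"] by linarith
    then show "\<exists>a\<in>set_mset p. count p a mod M + count p a div M < count p a"
      using a by blast
  qed simp
  finally show ?thesis
    by (simp add: size_multiset_overloaded_eq)
qed

lemma merge_iter_terminates:
  assumes "M \<ge> 2" "0 \<notin># p"
  obtains t where "merge_iter M p = Some t" "0 \<notin># t" "full_split M t = full_split M p"
    "\<forall>a\<in>#t. count t a < M"
proof -
  define P where "P r \<longleftrightarrow> 0 \<notin># r \<and> full_split M r = full_split M p" for r
  have step: "P (merge_step M r)" if "P r" for r
    using that assms(1) by (simp add: P_def zero_notin_merge_step full_split_merge_step)
  have init: "P p" using assms by (simp add: P_def)
  obtain t where t: "merge_iter M p = Some t"
    unfolding merge_iter_def
    using measure_while_option_Some[of P "\<lambda>p. \<exists>a\<in>#p. M \<le> count p a" "merge_step M" size p]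
      step init size_merge_step_less[OF assms(1)]
    by auto
  have "P t"
    using while_option_rule[of P, OF _ t[unfolded merge_iter_def] init] step by blast
  moreover have "\<forall>a\<in>#t. count t a < M"
    using while_option_stop[OF t[unfolded merge_iter_def]] by force
  ultimately show ?thesis
    using t that by (simp add: P_def)
qed

section \<open>Bijectivity of \<open>b_map\<close> and its inverse\<close>

lemma b_map_eq_full_split:
  assumes "M \<ge> 2" "p \<in> partitions N"
  shows "b_map M p = full_split M p"
  using assms by (simp add: b_map_def split_iter_eq_full_split partitions_def)

lemma full_split_in_C_partitions:
  assumes "M \<ge> 2" "p \<in> partitions N"
  shows "full_split M p \<in> C_partitions M N"
  using assms zero_notin_full_split[of p M] full_split_not_dvd[of M p]
  by (auto simp: C_partitions_def partitions_def cong_0_iff)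

lemma inj_on_b_map:
  assumes "M \<ge> 2"
  shows "inj_on (b_map M) (D_partitions M N)"
proof (rule inj_onI)
  fix p q
  assume pq: "p \<in> D_partitions M N" "q \<in> D_partitions M N" "b_map M p = b_map M q"
  \<comment> \<open>\<open>full_split_inject\<close> wants the bound for every number; one that is
    not a part has count 0, which is below \<open>M\<close>.\<close>
  have "\<forall>a. count r a < M" if "r \<in> D_partitions M N" for r
    using that assms by (force simp: D_partitions_def not_in_iff)
  moreover have "full_split M p = full_split M q"
    using pq assms b_map_eq_full_split[of M _ N] by (simp add: D_partitions_def)
  ultimately show "p = q"
    using full_split_inject[OF assms] pq by blast
qed

text \<open>\<open>full_split\<close> fixes \<open>p\<close> and is invariant under merging, so the
  merged multiset is mapped back to \<open>p\<close>. This gives surjectivity and later identifies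
  the inverse.\<close>

lemma merge_iter_section:
  assumes "M \<ge> 2" "p \<in> C_partitions M N"
  obtains t where "merge_iter M p = Some t" "t \<in> D_partitions M N" "b_map M t = p"
proof -
  have p: "0 \<notin># p" "\<Sum>\<^sub># p = N" "full_split M p = p"
    using assms(2) by (auto simp: C_partitions_def partitions_def cong_0_iff intro!: full_split_id)
  obtain t where t: "merge_iter M p = Some t" "0 \<notin># t" "full_split M t = full_split M p"
      "\<forall>a\<in>#t. count t a < M"
    using merge_iter_terminates[OF assms(1) p(1)] .
  then have "\<Sum>\<^sub># t = N"
    using p by (metis sum_mset_full_split)
  with t p have "t \<in> partitions N" by (simp add: partitions_def)
  with t p assms(1) show ?thesis
    by (intro that[of t]) (simp_all add: D_partitions_def b_map_eq_full_split)
qed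

lemma bij_betw_b_map:
  assumes "M \<ge> 2"
  shows "bij_betw (b_map M) (D_partitions M N) (C_partitions M N)"
proof -
  have "b_map M p \<in> C_partitions M N" if "p \<in> D_partitions M N" for p
    using that assms
    by (auto simp: D_partitions_def b_map_eq_full_split full_split_in_C_partitions)
  moreover have "p \<in> b_map M ` D_partitions M N" if "p \<in> C_partitions M N" for p
    using merge_iter_section[OF assms that] by blast
  ultimately show ?thesis
    using inj_on_b_map[OF assms] by (auto simp: bij_betw_def)
qed

subsection \<open>The product identity\<close>

text \<open>Truncation principle: multiplying by \<open>1 - fps_X ^ s\<close> changes only
  coefficients of order at least \<open>s\<close>.\<close>

lemma fps_nth_mult_prod_one_minus:
  fixes g :: "'a::comm_ring_1 fps"
  assumes "finite A" "\<forall>s\<in>A. k < s"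
  shows "fps_nth (g * (\<Prod>s\<in>A. 1 - fps_X ^ s)) k = fps_nth g k"
  using assms
proof (induction A rule: finite_induct)
  case (insert s A)
  have "g * (\<Prod>s\<in>insert s A. 1 - fps_X ^ s)
      = g * (\<Prod>s\<in>A. 1 - fps_X ^ s) - fps_X ^ s * (g * (\<Prod>s\<in>A. 1 - fps_X ^ s))"
    using insert.hyps by (simp add: algebra_simps)
  then show ?case
    using insert by (simp add: fps_X_power_mult_nth)
qed simp

lemma one_minus_fps_X_power_unit:
  assumes "k > 0"
  shows "(1 - fps_X ^ k :: 'a::field fps) * (1 / (1 - fps_X ^ k)) = 1"
proof -
  have "fps_nth (1 - fps_X ^ k :: 'a fps) 0 \<noteq> 0"
    using assms by simp
  then show ?thesis
    by (simp add: fps_divide_unit inverse_mult_eq_1')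
qed

lemma prod_one_minus_fps_X_power_unit:
  fixes m :: nat
  shows "\<exists>h. (\<Prod>s = 1..m. 1 - fps_X ^ s :: 'a::field fps) * h = 1"
proof
  show "(\<Prod>s = 1..m. 1 - fps_X ^ s :: 'a fps) * (\<Prod>s = 1..m. 1 / (1 - fps_X ^ s)) = 1"
    by (simp add: one_minus_fps_X_power_unit flip: prod.distrib)
qed

text \<open>\<open>f\<close> takes the neutral value 1 at multiples of \<open>M\<close>. In
  particular \<open>f 0 = 1\<close>, so products may start at index 0.\<close>

context
  fixes M :: nat and f :: "nat \<Rightarrow> 'a::field fps"
  assumes M: "M \<ge> 2"
  defines "f \<equiv> (\<lambda>k. if M dvd k then 1 else 1 / (1 - fps_X ^ k))"
begin

text \<open>The shorter product is expressed through the longer one because the correction then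
  consists of factors \<open>1 - fps_X ^ s\<close>, to which the truncation principle
  applies.\<close>

lemma partial_product_cancel:
  assumes "m \<le> n"
  shows "(\<Prod>i\<le>m. f i) = (\<Prod>i\<le>n. f i) * (\<Prod>s\<in>{s\<in>{m<..n}. \<not> M dvd s}. 1 - fps_X ^ s)"
proof -
  have "(\<Prod>s\<in>{s\<in>{m<..n}. \<not> M dvd s}. 1 - fps_X ^ s)
      = (\<Prod>s\<in>{m<..n}. if \<not> M dvd s then 1 - fps_X ^ s else (1 :: 'a fps))"
    by (rule prod.inter_filter) simp
  moreover have "(\<Prod>i\<le>n. f i) = (\<Prod>i\<le>m. f i) * (\<Prod>i\<in>{m<..n}. f i)"
    using assms by (subst prod.union_disjoint[symmetric]) (auto intro!: prod.cong)
  moreover have "(\<Prod>i\<in>{m<..n}. f i)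
      * (\<Prod>s\<in>{m<..n}. if \<not> M dvd s then 1 - fps_X ^ s else 1) = 1"
    unfolding prod.distrib[symmetric]
    by (rule prod.neutral) (auto simp: f_def mult.commute one_minus_fps_X_power_unit)
  ultimately show ?thesis by (simp add: mult.assoc)
qed

text \<open>The numerator is the product of \<open>1 - fps_X ^ s\<close> over the multiples
  \<open>s\<close> of \<open>M\<close> up to \<open>m * M\<close>. Those up to \<open>m\<close>
  cancel against the denominator and leave the factors \<open>f\<close>; the others have order above
  \<open>m\<close>.\<close>

lemma q_factorial_quotient:
  "q_factorial (fps_X ^ M) (int m) / q_factorial fps_X (int m)
    = (\<Prod>i\<le>m. f i) * (\<Prod>s\<in>{s\<in>{m<..m * M}. M dvd s}. 1 - fps_X ^ s)"
proof -
  let ?G = "\<Prod>s = 1..m. 1 - fps_X ^ s :: 'a fps"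
  let ?D = "\<lambda>A. \<Prod>s\<in>{s\<in>A. M dvd s}. 1 - fps_X ^ s :: 'a fps"
  have nz: "?G \<noteq> 0"
    using prod_one_minus_fps_X_power_unit[of m, where 'a = 'a] by (metis mult_zero_left zero_neq_one)
  have "?D {1..m} = (\<Prod>s = 1..m. if M dvd s then 1 - fps_X ^ s else 1)"
    by (rule prod.inter_filter) simp
  also have "\<dots> = (\<Prod>s = 1..m. f s * (1 - fps_X ^ s))"
    by (rule prod.cong) (auto simp: f_def mult.commute one_minus_fps_X_power_unit)
  also have "\<dots> = (\<Prod>s = 1..m. f s) * ?G"
    by (rule prod.distrib)
  also have "(\<Prod>s = 1..m. f s) = (\<Prod>i\<le>m. f i)"
    by (rule prod.mono_neutral_left) (auto simp: f_def not_less_eq_eq)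
  finally have D: "?D {1..m} = (\<Prod>i\<le>m. f i) * ?G" .
  have "q_factorial (fps_X ^ M) (int m) = (\<Prod>j = 1..m. 1 - (fps_X :: 'a fps) ^ (M * j))"
    by (simp add: q_factorial_def power_mult)
  also have "\<dots> = ?D {1..m * M}"
    using M by (intro prod.reindex_bij_witness[of _ "\<lambda>s. s div M" "\<lambda>j. M * j"])
      (auto elim!: dvdE simp: mult.commute)
  also have "\<dots> = ?D {1..m} * ?D {m<..m * M}"
  proof (subst prod.union_disjoint[symmetric])
    have "m \<le> m * M" using M by simp
    then show "?D {1..m * M}
        = (\<Prod>s\<in>{s\<in>{1..m}. M dvd s} \<union> {s\<in>{m<..m * M}. M dvd s}. 1 - fps_X ^ s)"
      by (intro prod.cong) (auto intro: order_trans)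
  qed auto
  finally have "q_factorial (fps_X ^ M) (int m)
      = ((\<Prod>i\<le>m. f i) * ?D {m<..m * M}) * ?G"
    using D by (simp add: mult_ac)
  then show ?thesis
    using nz by (simp add: q_factorial_def)
qed

lemma fps_nth_partial_product:
  assumes "k \<le> n"
  shows "fps_nth (\<Prod>i\<le>n. f i) k = fps_nth (\<Prod>i\<le>k. f i) k"
  unfolding partial_product_cancel[OF assms]
  by (rule fps_nth_mult_prod_one_minus[symmetric]) auto

lemma fps_nth_q_factorial_quotient:
  assumes "k \<le> n"
  shows "fps_nth (q_factorial (fps_X ^ M) (int n) / q_factorial fps_X (int n)) k
    = fps_nth (\<Prod>i\<le>k. f i) k"
proof -
  have "fps_nth (q_factorial (fps_X ^ M) (int n) / q_factorial fps_X (int n)) k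
      = fps_nth (\<Prod>i\<le>n. f i) k"
    unfolding q_factorial_quotient using assms by (intro fps_nth_mult_prod_one_minus) auto
  then show ?thesis
    by (simp only: fps_nth_partial_product[OF assms])
qed

text \<open>Telescoping: in the notation of the proof the new term is
  \<open>(y - x) * A / (x * B)\<close>, that is \<open>y * A / (x * B) - A / B\<close>.\<close>

lemma sum_q_factorial_terms:
  "(\<Sum>n<m. (fps_X ^ Suc n - fps_X ^ (Suc n * M)) * q_factorial (fps_X ^ M) (int (Suc n) - 1)
      / q_factorial fps_X (int (Suc n)))
    = q_factorial (fps_X ^ M) (int m) / q_factorial fps_X (int m) - (1 :: 'a fps)"
proof (induction m)
  case 0
  show ?case by (simp add: q_factorial_def)
next
  case (Suc m)
  define A where "A = q_factorial (fps_X ^ M :: 'a fps) (int m)"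
  define B where "B = q_factorial (fps_X :: 'a fps) (int m)"
  define x where "x = (1 - fps_X ^ Suc m :: 'a fps)"
  define y where "y = (1 - fps_X ^ (Suc m * M) :: 'a fps)"
  have A': "q_factorial (fps_X ^ M :: 'a fps) (int (Suc m)) = y * A"
    unfolding q_factorial_def A_def y_def nat_int
    by (simp add: mult.commute flip: power_mult power_Suc)
  have B': "q_factorial (fps_X :: 'a fps) (int (Suc m)) = x * B"
    unfolding q_factorial_def B_def x_def nat_int by (simp add: mult.commute)
  \<comment> \<open>Power series do not form a field; both quotients are rewritten as products with
    the inverse \<open>h\<close> of \<open>x * B\<close>.\<close>
  obtain h where h: "x * B * h = 1"
    using prod_one_minus_fps_X_power_unit[of "Suc m", where 'a = 'a] B'
    unfolding q_factorial_def nat_int by metis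
  have div: "z / (x * B) = z * h" for z
  proof -
    have "z = (z * h) * (x * B)" using h by (simp add: mult_ac)
    moreover have "x * B \<noteq> 0" using h by auto
    ultimately show ?thesis by (metis nonzero_mult_div_cancel_right)
  qed
  have divB: "A / B = A * x * h"
  proof -
    have "A = (A * x * h) * B" using h by (simp add: mult_ac)
    moreover have "B \<noteq> 0" using h by auto
    ultimately show ?thesis by (metis nonzero_mult_div_cancel_right)
  qed
  have "(fps_X ^ Suc m - fps_X ^ (Suc m * M)) = y - x"
    by (simp add: x_def y_def)
  moreover have "q_factorial (fps_X ^ M :: 'a fps) (int (Suc m) - 1) = A"
    by (simp add: A_def)
  ultimately show ?case
    unfolding sum.lessThan_Suc Suc.IH A' B' A_def[symmetric] B_def[symmetric] div divB
    by (simp only:) (simp add: algebra_simps)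
qed

lemma partial_product_limit:
  obtains L where "f has_prod L" "convergent_prod f"
    "(\<lambda>n. (fps_X ^ Suc n - fps_X ^ (Suc n * M)) * q_factorial (fps_X ^ M) (int (Suc n) - 1)
      / q_factorial fps_X (int (Suc n))) sums (L - 1)"
proof -
  \<comment> \<open>Coefficient \<open>k\<close> of the partial products is constant from index
    \<open>k\<close> on, so the diagonal gives the limit.\<close>
  define L where "L = Abs_fps (\<lambda>k. fps_nth (\<Prod>i\<le>k. f i) k)"
  have L_nth: "fps_nth L k = fps_nth (\<Prod>i\<le>k. f i) k" for k
    by (simp only: L_def fps_nth_Abs_fps)
  have "(\<lambda>n. \<Prod>i\<le>n. f i) \<longlonglongrightarrow> L"
    by (rule tendsto_fpsI, rule eventually_sequentiallyI, unfold L_nth)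
      (rule fps_nth_partial_product)
  \<comment> \<open>\<open>raw_has_prod\<close> demands a nonzero limit.\<close>
  moreover have "fps_nth L 0 = 1"
    by (simp add: L_nth f_def)
  ultimately have raw: "raw_has_prod f 0 L"
    by (auto simp: raw_has_prod_def)
  have sums: "(\<lambda>n. (fps_X ^ Suc n - fps_X ^ (Suc n * M)) * q_factorial (fps_X ^ M) (int (Suc n) - 1)
      / q_factorial fps_X (int (Suc n))) sums (L - 1)"
    unfolding sums_def sum_q_factorial_terms
  proof (rule tendsto_fpsI)
    fix k
    show "\<forall>\<^sub>F m in sequentially.
        fps_nth (q_factorial (fps_X ^ M) (int m) / q_factorial fps_X (int m) - 1) k
          = fps_nth (L - 1) k"
      using eventually_ge_at_top[of k]
      by eventually_elim (simp only: L_nth fps_sub_nth fps_nth_q_factorial_quotient)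
  qed
  show ?thesis
    using raw sums by (intro that[of L]) (auto simp: has_prod_def convergent_prod_def)
qed

end

theorem theorem5p3:
  fixes M N :: nat
  assumes "M \<ge> 2" and "N \<ge> 1"
  shows "((\<forall>p \<in> D_partitions M N. split_iter M p \<noteq> None)
      \<and> bij_betw (b_map M) (D_partitions M N) (C_partitions M N)
      \<and> (\<forall>p \<in> C_partitions M N.
            merge_iter M p = Some (inv_into (D_partitions M N) (b_map M) p)))
    \<and> (let q = (fps_X :: 'a::field fps);
           f = (\<lambda>k::nat. if [k = 0] (mod M) then 1 else 1 / (1 - q ^ k));
           t = (\<lambda>n::nat. (q ^ n - q ^ (n * M)) * q_factorial (q ^ M) (int n - 1)
                          / q_factorial q (int n))
       in convergent_prod f
        \<and> summable (\<lambda>n. t (Suc n))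
        \<and> prodinf f = 1 + (\<Sum>n. t (Suc n)))"
proof -
  have iter: "\<forall>p \<in> D_partitions M N. split_iter M p \<noteq> None"
    using assms(1) by (simp add: D_partitions_def partitions_def split_iter_eq_full_split)
  \<comment> \<open>The merged multiset is a preimage of \<open>p\<close> in
    \<open>D_partitions M N\<close>; by injectivity it is the one chosen by
    \<open>inv_into\<close>.\<close>
  have merge: "merge_iter M p = Some (inv_into (D_partitions M N) (b_map M) p)"
    if "p \<in> C_partitions M N" for p
    using merge_iter_section[OF assms(1) that] inj_on_b_map[OF assms(1)]
    by (metis inv_into_f_f)
  obtain L where L: "(\<lambda>k. if M dvd k then 1 else 1 / (1 - fps_X ^ k) :: 'a fps) has_prod L"
    "convergent_prod (\<lambda>k. if M dvd k then 1 else 1 / (1 - fps_X ^ k) :: 'a fps)"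
    "(\<lambda>n. (fps_X ^ Suc n - fps_X ^ (Suc n * M)) * q_factorial (fps_X ^ M) (int (Suc n) - 1)
      / q_factorial fps_X (int (Suc n))) sums (L - 1)"
    using partial_product_limit[OF assms(1)] .
  show ?thesis
    unfolding Let_def cong_0_iff
    using iter merge bij_betw_b_map[OF assms(1)] L(2) sums_summable[OF L(3)]
      has_prod_unique[OF L(1)] sums_unique[OF L(3)]
    by (metis add_diff_cancel_left' diff_add_cancel)
qed

end
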